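(* For all $m,n\in\mathbb{N}$, the graph $2LK_{1,m}\cup LK_{1,n}$ is super edge-magic.
   Context: Graphs are finite and undirected, may contain loops, but multiple edges are not allowed. $\mathbb{N}$ denotes the positive integers, and for integers $m\le n$, $[m,n]=\{m,m+1,\dots,n\}$. $LK_{1,n}$ is the graph obtained from the star $K_{1,n}$ (one central vertex joined to $n$ other vertices) by attaching a loop at its central vertex (for $n=1$: an edge with a loop at one of its two endpoints). For a positive integer $t$ and a graph $G$, $tG$ denotes the disjoint union of $t$ copies of $G$; $\cup$ denotes disjoint union of graphs. Let $G$ be a graph with $p$ vertices and $q$ edges (loops count as edges). $G$ is edge-magic if there is a bijection $f:V(G)\cup E(G)\to[1,p+q]$ and a constant $k$ such that $f(x)+f(xy)+f(y)=k$ for every edge $xy\in E(G)$ (for a loop, $x=y$). $G$ is super edge-magic if there is such an $f$ with, in addition, $f(V(G))=[1,p]$. It is known that, equivalently, $G$ is super edge-magic if and only if there is a bijection $g:V(G)\to[1,p]$ such that $\{g(u)+g(v):uv\in E(G)\}$ is a set of $q$ consecutive integers (a loop at $u$ contributes $2g(u)$). *)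

theory Defs
  imports Main
begin

text \<open>
  Finite undirected graphs, loops allowed, no multiple edges: an edge between \<open>x\<close> and \<open>y\<close> is
  the set \<open>{x, y}\<close>, so a loop at \<open>x\<close> is the singleton \<open>{x, x} = {x}\<close>.
\<close>

record 'a lgraph =
  verts :: "'a set"
  edges :: "'a set set"

definition wf_lgraph :: "'a lgraph \<Rightarrow> bool" where
  "wf_lgraph G \<longleftrightarrow> finite (verts G) \<and>
     (\<forall>e\<in>edges G. \<exists>x\<in>verts G. \<exists>y\<in>verts G. e = {x, y})"

definition star :: "nat \<Rightarrow> nat lgraph" where
  "star n = \<lparr>verts = {0..n}, edges = {{0, i} | i. i \<in> {1..n}}\<rparr>"

definition add_loop :: "'a \<Rightarrow> 'a lgraph \<Rightarrow> 'a lgraph" where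
  "add_loop x G = \<lparr>verts = verts G, edges = insert {x} (edges G)\<rparr>"

text \<open>The graph \<open>LK\<^bsub>1,n\<^esub>\<close>; the centre of the star is the vertex \<open>0\<close>.\<close>

definition LK1 :: "nat \<Rightarrow> nat lgraph" where
  "LK1 n = add_loop 0 (star n)"

definition disjoint_union :: "'a lgraph \<Rightarrow> 'b lgraph \<Rightarrow> ('a + 'b) lgraph" where
  "disjoint_union G H =
     \<lparr>verts = verts G <+> verts H,
      edges = (\<lambda>e. Inl ` e) ` edges G \<union> (\<lambda>e. Inr ` e) ` edges H\<rparr>"

definition copies :: "nat \<Rightarrow> 'a lgraph \<Rightarrow> (nat \<times> 'a) lgraph" where
  "copies t G =
     \<lparr>verts = {1..t} \<times> verts G,
      edges = {Pair j ` e | j e. j \<in> {1..t} \<and> e \<in> edges G}\<rparr>"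

text \<open>
  A labelling of vertices and edges is a function on the disjoint sum \<open>verts G <+> edges G\<close>:
  \<open>f (Inl x)\<close> is the label of the vertex \<open>x\<close> and \<open>f (Inr e)\<close> that of the edge \<open>e\<close>.
  In the magic condition the case \<open>x = y\<close> covers the loops.
\<close>

definition edge_magic_labeling :: "'a lgraph \<Rightarrow> ('a + 'a set \<Rightarrow> nat) \<Rightarrow> bool" where
  "edge_magic_labeling G f \<longleftrightarrow>
     bij_betw f (verts G <+> edges G) {1..card (verts G) + card (edges G)} \<and>
     (\<exists>k. \<forall>x y. {x, y} \<in> edges G \<longrightarrow> f (Inl x) + f (Inr {x, y}) + f (Inl y) = k)"

definition edge_magic :: "'a lgraph \<Rightarrow> bool" where
  "edge_magic G \<longleftrightarrow> (\<exists>f. edge_magic_labeling G f)"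

definition super_edge_magic :: "'a lgraph \<Rightarrow> bool" where
  "super_edge_magic G \<longleftrightarrow>
     (\<exists>f. edge_magic_labeling G f \<and> f ` (Inl ` verts G) = {1..card (verts G)})"

lemma wf_LK1: "wf_lgraph (LK1 n)"
  unfolding wf_lgraph_def LK1_def add_loop_def star_def by fastforce

lemma wf_disjoint_union:
  assumes "wf_lgraph G" "wf_lgraph H"
  shows "wf_lgraph (disjoint_union G H)"
  unfolding wf_lgraph_def
proof (intro conjI ballI)
  show "finite (verts (disjoint_union G H))"
    using assms by (simp add: wf_lgraph_def disjoint_union_def)
next
  fix e assume "e \<in> edges (disjoint_union G H)"
  then consider e' where "e' \<in> edges G" "e = Inl ` e'" | e' where "e' \<in> edges H" "e = Inr ` e'"
    by (auto simp: disjoint_union_def)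
  then show "\<exists>x\<in>verts (disjoint_union G H). \<exists>y\<in>verts (disjoint_union G H). e = {x, y}"
  proof cases
    case 1
    then obtain x y where "x \<in> verts G" "y \<in> verts G" "e' = {x, y}"
      using assms(1) unfolding wf_lgraph_def by blast
    then show ?thesis
      using 1(2) by (intro bexI[of _ "Inl x"] bexI[of _ "Inl y"]) (auto simp: disjoint_union_def)
  next
    case 2
    then obtain x y where "x \<in> verts H" "y \<in> verts H" "e' = {x, y}"
      using assms(2) unfolding wf_lgraph_def by blast
    then show ?thesis
      using 2(2) by (intro bexI[of _ "Inr x"] bexI[of _ "Inr y"]) (auto simp: disjoint_union_def)
  qed
qed

lemma wf_copies:
  assumes "wf_lgraph G"
  shows "wf_lgraph (copies t G)"
  unfolding wf_lgraph_def
proof (intro conjI ballI)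
  show "finite (verts (copies t G))"
    using assms by (simp add: wf_lgraph_def copies_def)
next
  fix e assume "e \<in> edges (copies t G)"
  then obtain j e' where je: "j \<in> {1..t}" "e' \<in> edges G" "e = Pair j ` e'"
    by (auto simp: copies_def)
  then obtain x y where "x \<in> verts G" "y \<in> verts G" "e' = {x, y}"
    using assms unfolding wf_lgraph_def by blast
  then show "\<exists>x\<in>verts (copies t G). \<exists>y\<in>verts (copies t G). e = {x, y}"
    using je by (intro bexI[of _ "(j, x)"] bexI[of _ "(j, y)"]) (auto simp: copies_def)
qed

end

theory Submission
  imports Defs
begin

text \<open>
  In \<open>2LK\<^bsub>1,m\<^esub> \<union> LK\<^bsub>1,n\<^esub>\<close> every vertex is joined to the centre of its own component, the centres
  to themselves by their loops. So edges correspond to vertices, and there are equally many, say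
  \<open>p\<close>. By the classical criterion (\<open>super_edge_magic_if_consecutive_sums\<close>) it suffices to label
  the vertices by \<open>1, \<dots>, p\<close> such that the \<open>p\<close> edge sums \<open>g x + g (centre of x)\<close> are consecutive,
  that is, such that adding to each label the label of its centre permutes \<open>{1..p}\<close> up to a
  common shift.

  Give the centres of the two copies of \<open>LK\<^bsub>1,m\<^esub>\<close> the labels \<open>2\<close> and \<open>4\<close>, and the centre of
  \<open>LK\<^bsub>1,n\<^esub>\<close> the label \<open>3\<close>. After subtracting the shift \<open>3\<close>, labels in the first copy
  move down by one, those in the second copy move up by one, and those of \<open>LK\<^bsub>1,n\<^esub>\<close> stay.
  Such a map is a permutation as soon as the labels of the two copies are matched into \<open>m + 1\<close>
  pairs of neighbours, the smaller label of each pair lying in the second copy. The pairs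
  \[(1,2),\ (4,5),\ (6,7),\ \dots,\ (2m+2, 2m+3)\]
  do this: \<open>2\<close> is the larger element of its pair and \<open>4\<close>, which occurs because \<open>m \<ge> 1\<close>,
  is the smaller element of its pair, while \<open>3\<close> is left over, as the three centres require.
  The labels \<open>2m + 4, \<dots>, p\<close> go to the leaves of \<open>LK\<^bsub>1,n\<^esub>\<close>.
\<close>

section \<open>Super edge-magic labellings from consecutive edge sums\<close>

text \<open>
  The minimum and the maximum make the sum of the end labels a function of the edge as a set,
  uniformly for loops, where the single end counts twice.
\<close>

definition edge_sum :: "('a \<Rightarrow> nat) \<Rightarrow> 'a set \<Rightarrow> nat" where
  "edge_sum g e = Min (g ` e) + Max (g ` e)"

lemma edge_sum_pair [simp]: "edge_sum g {x, y} = g x + g y"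
  by (simp add: edge_sum_def min_def max_def)

lemma bij_betw_reflect:
  fixes c :: nat
  assumes "b < c"
  shows "bij_betw (\<lambda>k. c - k) {a..b} {c - b..c - a}"
  by (rule bij_betw_byWitness[where f' = "\<lambda>k. c - k"]) (use assms in auto)

lemma bij_betw_case_sum_Plus:
  assumes "bij_betw g A C" "bij_betw h B D" "C \<inter> D = {}"
  shows "bij_betw (case_sum g h) (A <+> B) (C \<union> D)"
proof -
  have "bij_betw (case_sum g h) (Inl ` A) C" "bij_betw (case_sum g h) (Inr ` B) D"
    using assms(1,2) by (simp_all add: bij_betw_def inj_on_def image_image)
  then show ?thesis
    unfolding Plus_def using assms(3) by (rule bij_betw_combine)
qed

text \<open>
  The edges receive the labels above \<open>p\<close> in the order of decreasing edge sum, which makes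
  edge sum plus edge label constant.
\<close>

lemma super_edge_magic_if_consecutive_sums:
  assumes g: "bij_betw g (verts G) {1..card (verts G)}"
    and sums: "bij_betw (edge_sum g) (edges G) {s + 1..s + q}"
  shows "super_edge_magic G"
proof -
  define p where "p = card (verts G)"
  define h where "h e = s + q + p + 1 - edge_sum g e" for e
  define f where "f = case_sum g h"
  have q: "card (edges G) = q"
    using bij_betw_same_card[OF sums] by simp
  have "bij_betw (\<lambda>k. s + q + p + 1 - k) {s + 1..s + q} {p + 1..p + q}"
    using bij_betw_reflect[of "s + q" "s + q + p + 1" "s + 1"] by (simp add: add.commute)
  from bij_betw_trans[OF sums this] have h: "bij_betw h (edges G) {p + 1..p + q}"
    by (simp add: h_def[abs_def] comp_def)
  have "bij_betw f (verts G <+> edges G) ({1..p} \<union> {p + 1..p + q})"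
    unfolding f_def using g h by (intro bij_betw_case_sum_Plus) (auto simp: p_def)
  moreover have "{1..p} \<union> {p + 1..p + q} = {1..p + q}"
    by auto
  moreover have "f (Inl x) + f (Inr {x, y}) + f (Inl y) = s + q + p + 1"
    if "{x, y} \<in> edges G" for x y
  proof -
    have "g x + g y \<in> {s + 1..s + q}"
      using bij_betwE[OF sums] that edge_sum_pair[of g x y] by metis
    then show ?thesis
      by (simp add: f_def h_def)
  qed
  ultimately have "edge_magic_labeling G f"
    unfolding edge_magic_labeling_def p_def[symmetric] q by metis
  moreover have "f ` (Inl ` verts G) = {1..card (verts G)}"
    using g by (simp add: f_def image_image bij_betw_def)
  ultimately show ?thesis
    unfolding super_edge_magic_def by blast
qed

text \<open>
  A graph in which each vertex \<open>x\<close> selects one edge \<open>{x, \<phi> x}\<close> and every edge arises in this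
  way: distinct edge sums already force distinct vertices to select distinct edges, so the
  criterion can be checked on vertices.
\<close>

lemma super_edge_magic_functional_graph:
  assumes edges: "edges G = (\<lambda>x. {x, \<phi> x}) ` verts G"
    and g: "bij_betw g (verts G) {1..card (verts G)}"
    and \<tau>: "bij_betw \<tau> {1..card (verts G)} {1..card (verts G)}"
    and sum: "\<And>x. x \<in> verts G \<Longrightarrow> g x + g (\<phi> x) = s + \<tau> (g x)"
  shows "super_edge_magic G"
proof -
  let ?p = "card (verts G)"
  have "bij_betw ((+) s) {1..?p} {s + 1..s + ?p}"
    unfolding bij_betw_def image_add_atLeastAtMost by simp
  from bij_betw_trans[OF bij_betw_trans[OF g \<tau>] this]
  have "bij_betw ((+) s \<circ> (\<tau> \<circ> g)) (verts G) {s + 1..s + ?p}" .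
  then have "bij_betw (edge_sum g \<circ> (\<lambda>x. {x, \<phi> x})) (verts G) {s + 1..s + ?p}"
    by (subst bij_betw_cong[of _ _ "(+) s \<circ> (\<tau> \<circ> g)"]) (simp_all add: sum)
  then have "bij_betw (edge_sum g) (edges G) {s + 1..s + ?p}"
    unfolding edges bij_betw_def by (auto intro: inj_on_imageI simp: image_comp)
  with g show ?thesis
    by (rule super_edge_magic_if_consecutive_sums)
qed

section \<open>The union of three looped stars\<close>

abbreviation three_looped_stars :: "nat \<Rightarrow> nat \<Rightarrow> (nat \<times> nat + nat) lgraph" where
  "three_looped_stars m n \<equiv> disjoint_union (copies 2 (LK1 m)) (LK1 n)"

fun centre :: "nat \<times> nat + nat \<Rightarrow> nat \<times> nat + nat" where
  "centre (Inl (j, i)) = Inl (j, 0)"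
| "centre (Inr i) = Inr 0"

lemma verts_three_looped_stars:
  "verts (three_looped_stars m n) = ({1..2} \<times> {0..m}) <+> {0..n}"
  by (simp add: disjoint_union_def copies_def LK1_def add_loop_def star_def)

lemma card_verts_three_looped_stars: "card (verts (three_looped_stars m n)) = 2 * m + n + 3"
  unfolding verts_three_looped_stars by (simp add: card_Plus)

lemma edges_LK1: "edges (LK1 n) = (\<lambda>i. {i, 0}) ` {0..n}"
proof -
  have "{0..n} = insert 0 {1..n}"
    by auto
  then show ?thesis
    by (auto simp: LK1_def add_loop_def star_def insert_commute)
qed

lemma edges_copies: "edges (copies t G) = (\<Union>j\<in>{1..t}. (`) (Pair j) ` edges G)"
proof -
  have "{h j e | j e. j \<in> J \<and> e \<in> E} = (\<Union>j\<in>J. h j ` E)" for h :: "'b \<Rightarrow> 'c \<Rightarrow> 'd" and J E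
    by blast
  from this[of "\<lambda>j. (`) (Pair j)" "{1..t}" "edges G"] show ?thesis
    by (simp add: copies_def)
qed

lemma edges_three_looped_stars:
  "edges (three_looped_stars m n) = (\<lambda>x. {x, centre x}) ` verts (three_looped_stars m n)"
proof -
  have "{1..2 :: nat} \<times> {0..m} = (\<Union>j\<in>{1..2}. Pair j ` {0..m})"
    by auto
  then show ?thesis
    unfolding verts_three_looped_stars Plus_def
    by (simp add: disjoint_union_def edges_copies edges_LK1 image_Un image_UN image_image)
qed

text \<open>
  The leaf \<open>1\<close> of the second copy is exceptional: it gets \<open>1\<close>, the partner of the centre label
  \<open>2\<close> of the first copy. Symmetrically, the leaf \<open>1\<close> of the first copy gets \<open>5\<close>, the partner of
  the centre label \<open>4\<close> of the second. For \<open>i \<ge> 2\<close> the two leaves \<open>i\<close> are paired as \<open>(2i+2, 2i+3)\<close>.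
\<close>

fun label :: "nat \<Rightarrow> nat \<times> nat + nat \<Rightarrow> nat" where
  "label m (Inl (j, i)) =
     (if j = 1 then (if i = 0 then 2 else 2 * i + 3)
      else (if i = 0 then 4 else if i = 1 then 1 else 2 * i + 2))"
| "label m (Inr i) = (if i = 0 then 3 else 2 * m + 3 + i)"

text \<open>
  The involution \<open>(1 2)(4 5)(6 7)\<dots>(2m+2 2m+3)\<close>, which is the effect on the labels of adding
  the label of the centre and subtracting the shift \<open>3\<close>.
\<close>

definition swap_neighbours :: "nat \<Rightarrow> nat \<Rightarrow> nat" where
  "swap_neighbours m k =
     (if k = 1 then 2 else if k = 2 then 1
      else if 4 \<le> k \<and> k \<le> 2 * m + 3 then (if even k then k + 1 else k - 1)
      else k)"

lemma bij_betw_swap_neighbours: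
  assumes "2 * m + 3 \<le> p"
  shows "bij_betw (swap_neighbours m) {1..p} {1..p}"
proof (rule bij_betw_byWitness[where f' = "swap_neighbours m"])
  have involution: "swap_neighbours m (swap_neighbours m k) = k" for k
    unfolding swap_neighbours_def by (auto elim!: evenE oddE; presburger)
  then show "\<forall>k\<in>{1..p}. swap_neighbours m (swap_neighbours m k) = k"
    "\<forall>k\<in>{1..p}. swap_neighbours m (swap_neighbours m k) = k"
    by auto
  have "swap_neighbours m k \<in> {1..p}" if "k \<in> {1..p}" for k
    using assms that unfolding swap_neighbours_def by (auto elim!: evenE oddE; presburger)
  then show "swap_neighbours m ` {1..p} \<subseteq> {1..p}" "swap_neighbours m ` {1..p} \<subseteq> {1..p}"
    by auto
qed

lemma three_looped_stars_vertex_cases: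
  assumes "x \<in> verts (three_looped_stars m n)"
  obtains "x = Inl (1, 0)"
  | i where "x = Inl (1, i)" "1 \<le> i" "i \<le> m"
  | "x = Inl (2, 0)"
  | "x = Inl (2, 1)"
  | i where "x = Inl (2, i)" "2 \<le> i" "i \<le> m"
  | "x = Inr 0"
  | i where "x = Inr i" "1 \<le> i" "i \<le> n"
proof (cases x)
  case (Inl y)
  moreover obtain j i where "y = (j, i)"
    by fastforce
  ultimately show ?thesis
    using assms that unfolding verts_three_looped_stars
    by (cases "j = 1"; cases "i = 0"; cases "i = 1") auto
next
  case (Inr i)
  then show ?thesis
    using assms that unfolding verts_three_looped_stars by (cases "i = 0") auto
qed

lemma bij_betw_label:
  assumes "m \<ge> 1"
  shows "bij_betw (label m) (verts (three_looped_stars m n)) {1..2 * m + n + 3}"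
proof -
  let ?V = "verts (three_looped_stars m n)"
  have inj: "inj_on (label m) ?V"
  proof (rule inj_on_inverseI)
    let ?vertex = "\<lambda>k. if k = 1 then Inl (2, 1) else if k = 2 then Inl (1, 0)
      else if k = 3 then Inr 0 else if k = 4 then Inl (2, 0)
      else if 2 * m + 3 < k then Inr (k - (2 * m + 3))
      else if even k then Inl (2, k div 2 - 1) else Inl (1, (k - 3) div 2)"
    show "?vertex (label m x) = x" if "x \<in> ?V" for x
      using that by (cases rule: three_looped_stars_vertex_cases) (use assms in auto)
  qed
  moreover have "label m ` ?V \<subseteq> {1..2 * m + n + 3}"
    using assms by (auto elim: three_looped_stars_vertex_cases)
  moreover have "card (label m ` ?V) = card {1..2 * m + n + 3}"
    using card_image[OF inj] by (simp add: card_verts_three_looped_stars)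
  ultimately show ?thesis
    by (simp add: bij_betw_def card_subset_eq)
qed

lemma label_edge_sum:
  assumes "m \<ge> 1" "x \<in> verts (three_looped_stars m n)"
  shows "label m x + label m (centre x) = 3 + swap_neighbours m (label m x)"
  using assms(2)
  by (cases rule: three_looped_stars_vertex_cases)
    (use assms(1) in \<open>auto simp: swap_neighbours_def\<close>)

theorem theorem2p2:
  fixes m n :: nat
  assumes "m \<ge> 1" and "n \<ge> 1"
  shows "super_edge_magic (disjoint_union (copies 2 (LK1 m)) (LK1 n))"
proof (rule super_edge_magic_functional_graph[where \<phi> = centre and g = "label m"
      and \<tau> = "swap_neighbours m" and s = 3])
  let ?G = "three_looped_stars m n"
  show "edges ?G = (\<lambda>x. {x, centre x}) ` verts ?G"
    by (rule edges_three_looped_stars)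
  show "bij_betw (label m) (verts ?G) {1..card (verts ?G)}"
    using bij_betw_label[OF assms(1)] by (simp add: card_verts_three_looped_stars)
  show "bij_betw (swap_neighbours m) {1..card (verts ?G)} {1..card (verts ?G)}"
    by (rule bij_betw_swap_neighbours) (simp add: card_verts_three_looped_stars)
  show "label m x + label m (centre x) = 3 + swap_neighbours m (label m x)" if "x \<in> verts ?G" for x
    using assms(1) that by (rule label_edge_sum)
qed

end
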